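(* Let $t>0$. For every $V\in\mathcal F_t$ and every $x\in[0,1]$, $$\lim_{n\to\infty}(\mathcal R^n V)(x)=V^*(x),\qquad\text{where } V^*(x)=\log f_t'(x)=-\Big(1+\frac1t\Big)\log(1-x^t)$$ (here $f_t'$ refers to the formula for the first branch of $f_t$, and $V^*(1)=+\infty$).
   Context: For $t>0$, the first branch of the Manneville-Pomeau-like map $f_t$ is $f_t(x)=\dfrac{x}{(1-x^t)^{1/t}}$ for $0\le x\le 2^{-1/t}$. The set $\mathcal F_t$ consists of the non-negative continuous functions $V:[0,1]\to\mathbb R$ for which there is $\varepsilon>0$ such that $V(x)=(1+\frac1t)x^t+O(x^{t+\varepsilon})$ as $x\to0^+$. The renormalization operator $\mathcal R$ acts on functions $V$ on $[0,1]$ by $$(\mathcal R V)(x)=V\big(f_t(x/2^{1/t})\big)+V\big(x/2^{1/t}\big),\qquad x\in[0,1],$$ and $\mathcal R^n$ denotes its $n$-th iterate. *)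

theory Defs
  imports "HOL-Analysis.Analysis" "HOL-Library.Landau_Symbols"
begin

text \<open>
  The dynamical branch is the restriction of this formula to
  \<open>0 \<le> x \<le> 2 powr (- 1 / t)\<close>; the formula itself makes sense on \<open>{0..<1}\<close>,
  and its derivative is needed there.
\<close>
definition first_branch :: "real \<Rightarrow> real \<Rightarrow> real" where
  "first_branch t x = x / (1 - x powr t) powr (1 / t)"

text \<open>
  Functions on the unit interval are represented by functions on the reals; only their
  values on \<open>{0..1}\<close> are constrained or used.
\<close>
definition potential_class :: "real \<Rightarrow> (real \<Rightarrow> real) set" where
  "potential_class t =
     {V. continuous_on {0..1} V \<and> (\<forall>x\<in>{0..1}. 0 \<le> V x) \<and>
         (\<exists>\<epsilon>>0. (\<lambda>x. V x - (1 + 1 / t) * x powr t) \<in> O[at_right 0](\<lambda>x. x powr (t + \<epsilon>)))}"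

text \<open>
  For \<open>x \<in> {0..1}\<close> both arguments of \<open>V\<close> lie in \<open>{0..1}\<close>, so the values of the iterates on
  \<open>{0..1}\<close> depend only on \<open>V\<close> restricted to \<open>{0..1}\<close>.
\<close>
definition renorm :: "real \<Rightarrow> (real \<Rightarrow> real) \<Rightarrow> real \<Rightarrow> real" where
  "renorm t V = (\<lambda>x. V (first_branch t (x / 2 powr (1 / t))) + V (x / 2 powr (1 / t)))"

text \<open>The derivative is one-sided at \<open>0\<close>, hence taken within \<open>{0..<1}\<close>.\<close>
definition V_star :: "real \<Rightarrow> real \<Rightarrow> ereal" where
  "V_star t x =
     (if x < 1 then ereal (ln (vector_derivative (first_branch t) (at x within {0..<1}))) else \<infinity>)"

end

theory Submission imports Defs begin

text \<open>
  The map \<open>first_branch t\<close> is conjugate to a translation: in the coordinate \<open>s = x powr (- t)\<close> it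
  becomes \<open>s \<mapsto> s - 1\<close>, and the scaling \<open>x \<mapsto> x / 2 powr (1 / t)\<close> becomes
  \<open>s \<mapsto> 2 * s\<close>.  The renormalization operator therefore sums \<open>V\<close> over the two points
  \<open>2 * s\<close> and \<open>2 * s - 1\<close>, and its \<open>n\<close>-th iterate sums \<open>V\<close> over the points \<open>2 ^ n * s - k\<close>
  with \<open>k < 2 ^ n\<close>, a Birkhoff sum along an orbit of the first branch
  (\<open>renorm_iterate_eq_orbit_sum\<close>).

  If \<open>u = x powr t\<close> lies strictly between \<open>0\<close> and \<open>1\<close>, all these points have a large coordinate, so that \<open>V\<close> may be replaced by
  its leading term \<open>(1 + 1 / t) * y powr t\<close>.  The sum of the leading terms is \<open>1 + 1 / t\<close> times
  the sum of \<open>u / (N - k * u)\<close> over \<open>k < N\<close>, where \<open>N = 2 ^ n\<close>; this is a Riemann sum for the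
  integral of \<open>u / (1 - s * u)\<close> over the unit interval, whose value is \<open>- ln (1 - u)\<close>
  (\<open>log_riemann_sum_tendsto\<close>).  The remainders contribute \<open>N\<close> terms of order
  \<open>N powr (- 1 - \<epsilon> / t)\<close>.

  At \<open>x = 1\<close> the orbit is \<open>j powr (- 1 / t)\<close> with \<open>1 \<le> j \<le> 2 ^ n\<close>, along which \<open>V\<close> is at least a
  constant multiple of \<open>1 / j\<close> for large \<open>j\<close>; the sums diverge with the harmonic series.  At
  \<open>x = 0\<close> every term is \<open>V 0\<close>, which vanishes by continuity.
\<close>

section \<open>Iterates of the renormalization operator as orbit sums\<close>

text \<open>
  For \<open>x > 0\<close>, the point with coordinate \<open>m * x powr (- t) - k\<close>, where the coordinate of \<open>y\<close> is
  \<open>y powr (- t)\<close>.  For a natural number \<open>k < m\<close> and \<open>x\<close> in the unit interval it is the \<open>k\<close>-th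
  iterate of the first branch, started at \<open>x / m powr (1 / t)\<close>.
\<close>
definition orbit_point :: "real \<Rightarrow> real \<Rightarrow> real \<Rightarrow> real \<Rightarrow> real" where
  "orbit_point t m k x = x / (m - k * x powr t) powr (1 / t)"

lemma orbit_point_powr:
  assumes "t > 0" "x \<ge> 0" "m - k * x powr t > 0"
  shows "orbit_point t m k x powr t = x powr t / (m - k * x powr t)"
  using assms by (simp add: orbit_point_def powr_divide powr_powr)

text \<open>
  In the coordinate these maps are affine, \<open>s \<mapsto> p * s - l\<close> followed by \<open>s \<mapsto> m * s - k\<close>, and
  the last two hypotheses say for \<open>x > 0\<close> that both image coordinates are positive.
\<close>
lemma orbit_point_compose:
  assumes "t > 0" "x \<ge> 0" "p - l * x powr t > 0" "m * (p - l * x powr t) - k * x powr t > 0"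
  shows "orbit_point t m k (orbit_point t p l x) = orbit_point t (m * p) (m * l + k) x"
proof -
  define u where "u = x powr t"
  define w where "w = p - l * u"
  have w: "w > 0" using assms by (simp add: w_def u_def)
  have pos: "m * w - k * u > 0" using assms by (simp add: w_def u_def)
  have eq: "m - k * (u / w) = (m * w - k * u) / w"
    using w by (simp add: field_simps)
  have powr_eq: "(m - k * (u / w)) powr (1 / t) = (m * w - k * u) powr (1 / t) / w powr (1 / t)"
    unfolding eq using w pos by (simp add: powr_divide)
  have "orbit_point t m k (orbit_point t p l x)
      = x / w powr (1 / t) / (m - k * (u / w)) powr (1 / t)"
    using orbit_point_powr[OF assms(1-3)]
    by (simp add: orbit_point_def[of t m] w_def u_def) (simp add: orbit_point_def)
  also have "\<dots> = x / (m * w - k * u) powr (1 / t)"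
    unfolding powr_eq using w by simp
  also have "m * w - k * u = m * p - (m * l + k) * u"
    by (simp add: w_def algebra_simps)
  finally show ?thesis by (simp add: orbit_point_def u_def)
qed

lemma renorm_eq_orbit_points:
  assumes "t > 0" "x \<in> {0..1}"
  shows "renorm t V x = V (orbit_point t 2 1 x) + V (orbit_point t 2 0 x)"
proof -
  have u: "x powr t \<le> 1" using assms by (simp add: powr_le1)
  have half: "x / 2 powr (1 / t) = orbit_point t 2 0 x"
    by (simp add: orbit_point_def)
  have "first_branch t (orbit_point t 2 0 x) = orbit_point t 1 1 (orbit_point t 2 0 x)"
    by (simp add: first_branch_def orbit_point_def)
  also have "\<dots> = orbit_point t 2 1 x"
    using orbit_point_compose[of t x 2 0 1 1] assms u by simp
  finally show ?thesis by (simp add: renorm_def half)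
qed

lemma orbit_point_in_unit:
  assumes "t > 0" "x \<in> {0..1}" "k \<ge> 0" "k + 1 \<le> m"
  shows "orbit_point t m k x \<in> {0..1}"
proof -
  have u: "x powr t \<le> 1" using assms by (simp add: powr_le1)
  have "k * x powr t \<le> k" using u assms by (simp add: mult_left_le)
  then have "1 \<le> m - k * x powr t" using assms by simp
  then have "1 \<le> (m - k * x powr t) powr (1 / t)"
    using assms by (simp add: ge_one_powr_ge_zero)
  then have "x \<le> (m - k * x powr t) powr (1 / t)" using assms(2) by simp
  moreover have "(m - k * x powr t) powr (1 / t) > 0"
    using \<open>1 \<le> m - k * x powr t\<close> by simp
  ultimately show ?thesis using assms(2)
    by (simp add: orbit_point_def divide_le_eq_1)
qed

lemma sum_lessThan_add: "(\<Sum>k<m + n. f k) = (\<Sum>k<m. f k) + (\<Sum>k<n. f (m + k))"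
  for f :: "nat \<Rightarrow> 'a::comm_monoid_add"
  by (induction n) (simp_all add: add.assoc)

lemma renorm_iterate_eq_orbit_sum:
  assumes "t > 0" "x \<in> {0..1}"
  shows "(renorm t ^^ n) V x = (\<Sum>k<2 ^ n. V (orbit_point t (2 ^ n) (real k) x))"
  using assms(2)
proof (induction n arbitrary: x)
  case 0
  then show ?case by (simp add: orbit_point_def)
next
  case (Suc n)
  define N :: nat where "N = 2 ^ n"
  define W where "W k = V (orbit_point t (2 ^ Suc n) (real k) x)" for k
  have u: "x powr t \<le> 1" using assms(1) Suc.prems by (simp add: powr_le1)
  have step: "V (orbit_point t N k (orbit_point t 2 l x)) = W (N * l + k)"
    if "k < N" "l \<le> 1" for k l :: nat
  proof -
    have "real l * x powr t \<le> 1"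
      using that u by (intro mult_le_one) auto
    then have a: "2 - real l * x powr t \<ge> 1" by simp
    have "real k * x powr t \<le> real k" using u by (simp add: mult_left_le)
    also have "\<dots> < real N * 1" using that by simp
    also have "\<dots> \<le> real N * (2 - real l * x powr t)" using a by (intro mult_left_mono) auto
    finally have b: "real N * (2 - real l * x powr t) - real k * x powr t > 0" by simp
    have "orbit_point t N k (orbit_point t 2 l x) = orbit_point t (real N * 2) (real N * real l + real k) x"
      using assms(1) Suc.prems a b by (intro orbit_point_compose) auto
    then show ?thesis by (simp add: W_def N_def mult.commute)
  qed
  have "(renorm t ^^ Suc n) V x
      = (renorm t ^^ n) V (orbit_point t 2 1 x) + (renorm t ^^ n) V (orbit_point t 2 0 x)"
    using renorm_eq_orbit_points[OF assms(1) Suc.prems] by simp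
  also have "\<dots> = (\<Sum>k<N. V (orbit_point t N k (orbit_point t 2 1 x)))
                 + (\<Sum>k<N. V (orbit_point t N k (orbit_point t 2 0 x)))"
    using orbit_point_in_unit[OF assms(1) Suc.prems, of 1 2]
          orbit_point_in_unit[OF assms(1) Suc.prems, of 0 2]
    by (simp add: Suc.IH N_def)
  also have "\<dots> = (\<Sum>k<N. W (N + k)) + (\<Sum>k<N. W k)"
    using step[of _ 1] step[of _ 0] by simp
  also have "\<dots> = (\<Sum>k<N + N. W k)"
    by (simp add: sum_lessThan_add add.commute)
  also have "N + N = 2 ^ Suc n" by (simp add: N_def)
  finally show ?case by (simp add: W_def)
qed

section \<open>A Riemann sum for the logarithm\<close>

text \<open>
  The mesh values \<open>N - k * u\<close> decrease in steps of \<open>u\<close>, so the logarithm's tangent bounds turn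
  each term into a difference of logarithms; both estimates then telescope.
\<close>
lemma log_riemann_sum_bounds:
  fixes u :: real
  assumes "0 \<le> u" "u < 1" "N > 0"
  shows "(\<Sum>k<N. u / (real N - real k * u)) \<le> - ln (1 - u)"
    and "- ln (1 - u) - u / (real N * (1 - u)) \<le> (\<Sum>k<N. u / (real N - real k * u))"
proof -
  define a where "a k = real N - real k * u" for k :: nat
  have pos: "a k > 0" if "k \<le> N" for k
  proof -
    have "real k * u \<le> real N * u" using that assms by (intro mult_right_mono) auto
    also have "\<dots> < real N" using assms by simp
    finally show ?thesis by (simp add: a_def)
  qed
  have a_Suc: "a k - a (Suc k) = u" for k by (simp add: a_def algebra_simps)
  have aN: "a N = real N * (1 - u)" by (simp add: a_def algebra_simps)
  have a0: "a 0 = real N" by (simp add: a_def)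
  have "ln (a 0) - ln (a N) = - ln (1 - u)"
    using assms by (simp add: aN a0 ln_mult)
  then have tele: "(\<Sum>k<N. ln (a k) - ln (a (Suc k))) = - ln (1 - u)"
    using sum_lessThan_telescope'[of "\<lambda>k. ln (a k)" N] by simp
  have "(\<Sum>k<N. u / a k) \<le> (\<Sum>k<N. ln (a k) - ln (a (Suc k)))"
  proof (rule sum_mono)
    fix k assume "k \<in> {..<N}"
    then have "ln (a (Suc k)) - ln (a k) \<le> (a (Suc k) - a k) / a k"
      using pos[of k] pos[of "Suc k"] by (intro ln_diff_le) auto
    also have "a (Suc k) - a k = - u" using a_Suc[of k] by simp
    finally show "u / a k \<le> ln (a k) - ln (a (Suc k))" by simp
  qed
  with tele show "(\<Sum>k<N. u / (real N - real k * u)) \<le> - ln (1 - u)" by (simp add: a_def)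
  have "(\<Sum>k<N. ln (a k) - ln (a (Suc k))) \<le> (\<Sum>k<N. u / a (Suc k))"
  proof (rule sum_mono)
    fix k assume "k \<in> {..<N}"
    then show "ln (a k) - ln (a (Suc k)) \<le> u / a (Suc k)"
      using ln_diff_le[of "a k" "a (Suc k)"] pos[of k] pos[of "Suc k"] a_Suc[of k] by simp
  qed
  also have "\<dots> = (\<Sum>k<N. u / a k) + (u / a N - u / a 0)"
    using sum_lessThan_telescope[of "\<lambda>k. u / a k" N] by (simp add: sum_subtractf)
  also have "\<dots> \<le> (\<Sum>k<N. u / a k) + u / a N"
    using assms a0 by simp
  finally show "- ln (1 - u) - u / (real N * (1 - u)) \<le> (\<Sum>k<N. u / (real N - real k * u))"
    using tele by (simp add: a_def algebra_simps)
qed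

lemma log_riemann_sum_tendsto:
  fixes u :: real
  assumes "0 \<le> u" "u < 1"
  shows "(\<lambda>N. \<Sum>k<N. u / (real N - real k * u)) \<longlonglongrightarrow> - ln (1 - u)"
proof (rule tendsto_sandwich)
  show "eventually (\<lambda>N. - ln (1 - u) - u / (real N * (1 - u))
          \<le> (\<Sum>k<N. u / (real N - real k * u))) sequentially"
    using eventually_gt_at_top[of 0] by eventually_elim (use log_riemann_sum_bounds assms in auto)
  show "eventually (\<lambda>N. (\<Sum>k<N. u / (real N - real k * u)) \<le> - ln (1 - u)) sequentially"
    using eventually_gt_at_top[of 0] by eventually_elim (use log_riemann_sum_bounds assms in auto)
  have "(\<lambda>N. - ln (1 - u) - u / (1 - u) * inverse (real N)) \<longlonglongrightarrow> - ln (1 - u) - u / (1 - u) * 0"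
    by (intro tendsto_intros lim_inverse_n)
  then show "(\<lambda>N. - ln (1 - u) - u / (real N * (1 - u))) \<longlonglongrightarrow> - ln (1 - u)"
    by (simp add: field_simps)
qed simp

section \<open>Potentials near the indifferent fixed point\<close>

lemma potential_class_expansion:
  assumes "V \<in> potential_class t"
  obtains C \<epsilon> \<delta> where "C > 0" "\<epsilon> > 0" "\<delta> > 0"
    "\<And>y. 0 < y \<Longrightarrow> y < \<delta> \<Longrightarrow> \<bar>V y - (1 + 1 / t) * y powr t\<bar> \<le> C * y powr (t + \<epsilon>)"
proof -
  obtain \<epsilon> where e: "\<epsilon> > 0"
      "(\<lambda>x. V x - (1 + 1 / t) * x powr t) \<in> O[at_right 0](\<lambda>x. x powr (t + \<epsilon>))"
    using assms by (auto simp: potential_class_def)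
  obtain C where C: "C > 0"
      "eventually (\<lambda>x. norm (V x - (1 + 1 / t) * x powr t) \<le> C * norm (x powr (t + \<epsilon>))) (at_right 0)"
    using landau_o.bigE[OF e(2)] by blast
  then obtain \<delta> where "\<delta> > 0"
      "\<And>y. 0 < y \<Longrightarrow> y < \<delta> \<Longrightarrow> norm (V y - (1 + 1 / t) * y powr t) \<le> C * norm (y powr (t + \<epsilon>))"
    by (auto simp: eventually_at_right_field)
  with that[of C \<epsilon> \<delta>] e C show thesis by simp
qed

lemma potential_class_tendsto_at_0:
  assumes "t > 0" "V \<in> potential_class t"
  shows "(V \<longlongrightarrow> 0) (at_right 0)"
proof -
  obtain C \<epsilon> \<delta> where C: "C > 0" "\<epsilon> > 0" "\<delta> > 0"
    "\<And>y. 0 < y \<Longrightarrow> y < \<delta> \<Longrightarrow> \<bar>V y - (1 + 1 / t) * y powr t\<bar> \<le> C * y powr (t + \<epsilon>)"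
    using potential_class_expansion[OF assms(2)] by metis
  have powr0: "((\<lambda>y::real. y powr a) \<longlongrightarrow> 0) (at_right 0)" if "a > 0" for a
    using that by (intro tendsto_zero_powrI[where b = a]) (auto simp: eventually_at_filter)
  have "((\<lambda>y. V y - (1 + 1 / t) * y powr t) \<longlongrightarrow> 0) (at_right 0)"
  proof (rule Lim_null_comparison)
    show "eventually (\<lambda>y. norm (V y - (1 + 1 / t) * y powr t) \<le> C * y powr (t + \<epsilon>)) (at_right 0)"
      using C by (auto simp: eventually_at_right_field)
    show "((\<lambda>y. C * y powr (t + \<epsilon>)) \<longlongrightarrow> 0) (at_right 0)"
      using tendsto_mult_right_zero[OF powr0[of "t + \<epsilon>"]] C assms by simp
  qed
  from tendsto_add[OF this tendsto_mult_right_zero[OF powr0[OF assms(1)], of "1 + 1 / t"]]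
  show ?thesis by simp
qed

lemma potential_class_zero:
  assumes "t > 0" "V \<in> potential_class t"
  shows "V 0 = 0"
proof -
  have "continuous (at 0 within {0..1}) V"
    using assms by (auto simp: potential_class_def continuous_on_eq_continuous_within)
  then have "(V \<longlongrightarrow> V 0) (at 0 within {0..1})" by (simp add: continuous_within)
  then have "(V \<longlongrightarrow> V 0) (at_right 0)" by (simp add: at_within_Icc_at_right)
  with potential_class_tendsto_at_0[OF assms] show ?thesis
    using tendsto_unique trivial_limit_at_right_real by metis
qed

section \<open>Convergence of the orbit sums\<close>

text \<open>
  Every orbit point is at most \<open>m = (u / (N * (1 - u))) powr (1 / t)\<close>, where \<open>u = x powr t\<close>, so
  the remainders of \<open>V\<close> add up to at most \<open>C * N * m powr (t + \<epsilon>) = C * (u / (1 - u)) * m powr \<epsilon>\<close>,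
  which vanishes in the limit because \<open>m\<close> does.
\<close>
lemma orbit_sum_tendsto_interior:
  assumes "t > 0" "V \<in> potential_class t" "0 < x" "x < 1"
  shows "(\<lambda>N. \<Sum>k<N. V (orbit_point t (real N) (real k) x))
           \<longlonglongrightarrow> - (1 + 1 / t) * ln (1 - x powr t)"
proof -
  define u where "u = x powr t"
  have u: "0 < u" "u < 1" using assms by (simp_all add: u_def powr01_less_one)
  define y where "y N k = orbit_point t (real N) (real k) x" for N k :: nat
  define m where "m N = (u / (real N * (1 - u))) powr (1 / t)" for N :: nat
  obtain C \<epsilon> \<delta> where C: "C > 0" "\<epsilon> > 0" "\<delta> > 0"
    "\<And>z. 0 < z \<Longrightarrow> z < \<delta> \<Longrightarrow> \<bar>V z - (1 + 1 / t) * z powr t\<bar> \<le> C * z powr (t + \<epsilon>)"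
    using potential_class_expansion[OF assms(2)] by metis
  have D: "real N * (1 - u) \<le> real N - real k * u" "0 < real N * (1 - u)" if "k < N" for N k
  proof -
    have "real k * u \<le> real N * u" using that u by (intro mult_right_mono) auto
    then show "real N * (1 - u) \<le> real N - real k * u" by (simp add: algebra_simps)
    show "0 < real N * (1 - u)" using that u by simp
  qed
  have y_powr: "y N k powr t = u / (real N - real k * u)" if "k < N" for N k
    using orbit_point_powr[of t x "real N" "real k"] D[OF that] assms by (simp add: y_def u_def)
  have y_pos: "y N k > 0" if "k < N" for N k
    using D[OF that] assms by (simp add: y_def orbit_point_def u_def)
  have y_le: "y N k \<le> m N" if "k < N" for N k
  proof -
    have "y N k = (y N k powr t) powr (1 / t)"
      using y_pos[OF that] assms by (simp add: powr_powr)
    also have "\<dots> \<le> (u / (real N * (1 - u))) powr (1 / t)"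
      unfolding y_powr[OF that] using D[OF that] u assms
      by (intro powr_mono2 divide_left_mono divide_nonneg_nonneg) (auto intro!: mult_pos_pos)
    finally show ?thesis by (simp add: m_def)
  qed
  have "(\<lambda>N. u / (1 - u) * inverse (real N)) \<longlonglongrightarrow> u / (1 - u) * 0"
    by (intro tendsto_intros lim_inverse_n)
  then have "(\<lambda>N. u / (real N * (1 - u))) \<longlonglongrightarrow> 0" by (simp add: field_simps)
  then have m0: "m \<longlonglongrightarrow> 0"
    unfolding m_def using u assms by (intro tendsto_zero_powrI[where b = "1 / t"]) auto
  have err0: "(\<lambda>N. C * (u / (1 - u)) * m N powr \<epsilon>) \<longlonglongrightarrow> 0"
    by (intro tendsto_mult_right_zero tendsto_zero_powrI[where b = \<epsilon>] m0) (use C in \<open>auto simp: m_def\<close>)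
  have bound: "eventually (\<lambda>N. norm (\<Sum>k<N. V (y N k) - (1 + 1 / t) * y N k powr t)
                 \<le> C * (u / (1 - u)) * m N powr \<epsilon>) sequentially"
    using order_tendstoD(2)[OF m0 C(3)] eventually_gt_at_top[of 0]
  proof eventually_elim
    case (elim N)
    have "norm (\<Sum>k<N. V (y N k) - (1 + 1 / t) * y N k powr t) \<le> (\<Sum>k<N. C * m N powr (t + \<epsilon>))"
    proof (rule sum_norm_le)
      fix k assume "k \<in> {..<N}"
      then have k: "k < N" by simp
      have "norm (V (y N k) - (1 + 1 / t) * y N k powr t) \<le> C * y N k powr (t + \<epsilon>)"
        using C(4)[of "y N k"] y_pos[OF k] y_le[OF k] elim by simp
      also have "\<dots> \<le> C * m N powr (t + \<epsilon>)"
        using C y_pos[OF k] y_le[OF k] assms by (intro mult_left_mono powr_mono2) auto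
      finally show "norm (V (y N k) - (1 + 1 / t) * y N k powr t) \<le> C * m N powr (t + \<epsilon>)" .
    qed
    also have "\<dots> = C * (real N * m N powr t) * m N powr \<epsilon>"
      by (simp add: powr_add)
    also have "real N * m N powr t = u / (1 - u)"
      using u elim assms by (simp add: m_def powr_powr)
    finally show ?case .
  qed
  have "(\<lambda>N. \<Sum>k<N. V (y N k) - (1 + 1 / t) * y N k powr t) \<longlonglongrightarrow> 0"
    using Lim_null_comparison[OF bound err0] .
  moreover have "(\<lambda>N. (1 + 1 / t) * (\<Sum>k<N. u / (real N - real k * u))) \<longlonglongrightarrow> (1 + 1 / t) * (- ln (1 - u))"
    using u by (intro tendsto_mult_left log_riemann_sum_tendsto) auto
  ultimately have "(\<lambda>N. (\<Sum>k<N. V (y N k) - (1 + 1 / t) * y N k powr t)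
      + (1 + 1 / t) * (\<Sum>k<N. u / (real N - real k * u))) \<longlonglongrightarrow> 0 + (1 + 1 / t) * (- ln (1 - u))"
    by (rule tendsto_add)
  moreover have "(\<Sum>k<N. V (y N k) - (1 + 1 / t) * y N k powr t)
      + (1 + 1 / t) * (\<Sum>k<N. u / (real N - real k * u)) = (\<Sum>k<N. V (y N k))" for N
    by (simp add: sum_subtractf sum_distrib_left y_powr)
  ultimately show ?thesis by (simp add: y_def u_def left_diff_distrib distrib_right)
qed

text \<open>
  For small \<open>y\<close> the remainder of \<open>V\<close> is at most half of \<open>y powr t\<close>, hence
  \<open>V y \<ge> y powr t / 2\<close>.  Along \<open>y = j powr (- 1 / t)\<close> this compares \<open>V\<close> with the harmonic series.
\<close>
lemma potential_not_summable:
  assumes "t > 0" "V \<in> potential_class t"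
  shows "\<not> summable (\<lambda>j. V (real (Suc j) powr (- 1 / t)))"
proof
  assume sm: "summable (\<lambda>j. V (real (Suc j) powr (- 1 / t)))"
  obtain C \<epsilon> \<delta> where C: "C > 0" "\<epsilon> > 0" "\<delta> > 0"
    "\<And>z. 0 < z \<Longrightarrow> z < \<delta> \<Longrightarrow> \<bar>V z - (1 + 1 / t) * z powr t\<bar> \<le> C * z powr (t + \<epsilon>)"
    using potential_class_expansion[OF assms(2)] by metis
  define z where "z j = real (Suc j) powr (- 1 / t)" for j
  have z_pos: "z j > 0" for j by (simp add: z_def)
  have z_powr: "z j powr t = 1 / real (Suc j)" for j
    using assms unfolding z_def powr_powr by (simp add: powr_minus_divide)
  have z0: "z \<longlonglongrightarrow> 0"
    unfolding z_def using assms
    by (intro tendsto_neg_powr filterlim_compose[OF filterlim_real_sequentially filterlim_Suc]) auto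
  have "(\<lambda>j. C * z j powr \<epsilon>) \<longlonglongrightarrow> 0"
    by (intro tendsto_mult_right_zero tendsto_zero_powrI[where b = \<epsilon>] z0) (use C z_pos in \<open>auto simp: less_imp_le\<close>)
  then have "eventually (\<lambda>j. C * z j powr \<epsilon> < 1 / 2) sequentially"
    by (rule order_tendstoD) simp
  then have "eventually (\<lambda>j. norm (1 / real (Suc j)) \<le> 2 * V (z j)) sequentially"
    using order_tendstoD(2)[OF z0 C(3)]
  proof eventually_elim
    case (elim j)
    have "C * z j powr (t + \<epsilon>) = z j powr t * (C * z j powr \<epsilon>)" by (simp add: powr_add)
    also have "\<dots> \<le> z j powr t * (1 / 2)" using elim by (intro mult_left_mono) auto
    finally have "V (z j) \<ge> (1 + 1 / t) * z j powr t - z j powr t / 2"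
      using C(4)[OF z_pos elim(2)] by simp
    moreover have "(1 + 1 / t) * z j powr t \<ge> 1 * z j powr t"
      using assms by (intro mult_right_mono) auto
    ultimately have "z j powr t \<le> 2 * V (z j)" by simp
    then show ?case by (simp only: z_powr) simp
  qed
  moreover have "summable (\<lambda>j. 2 * V (z j))"
    using sm by (simp add: z_def summable_mult)
  ultimately have "summable (\<lambda>j. 1 / real (Suc j))"
    by (rule summable_comparison_test_ev)
  then have "summable (\<lambda>j. inverse (real (Suc j)))"
    by (simp add: field_simps)
  then show False
    using not_summable_harmonic[where 'a = real] summable_Suc_iff[of "\<lambda>n. inverse (real n)"] by simp
qed

lemma filterlim_sum_at_top_if_not_summable:
  fixes f :: "nat \<Rightarrow> real"
  assumes "\<And>n. f n \<ge> 0" "\<not> summable f"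
  shows "filterlim (\<lambda>n. \<Sum>k<n. f k) at_top sequentially"
  unfolding filterlim_at_top
proof
  fix Z
  have "\<exists>n. (\<Sum>k\<le>n. f k) > Z"
    using bounded_imp_summable[of f Z] assms by (meson not_less)
  then obtain n where n: "(\<Sum>k\<le>n. f k) > Z" ..
  show "eventually (\<lambda>n. Z \<le> (\<Sum>k<n. f k)) sequentially"
    using eventually_gt_at_top[of n]
  proof eventually_elim
    case (elim m)
    have "(\<Sum>k\<le>n. f k) \<le> (\<Sum>k<m. f k)"
      using elim assms by (intro sum_mono2) auto
    with n show ?case by simp
  qed
qed

lemma orbit_sum_diverges_at_1:
  assumes "t > 0" "V \<in> potential_class t"
  shows "filterlim (\<lambda>N. \<Sum>k<N. V (orbit_point t (real N) (real k) 1)) at_top sequentially"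
proof -
  have "V (real (Suc j) powr (- 1 / t)) \<ge> 0" for j
  proof -
    have "1 \<le> real (Suc j) powr (1 / t)" using assms by (intro ge_one_powr_ge_zero) auto
    then have "real (Suc j) powr (- 1 / t) \<in> {0..1}"
      by (simp add: powr_minus_divide)
    then show ?thesis using assms unfolding potential_class_def by blast
  qed
  then have "filterlim (\<lambda>N. \<Sum>j<N. V (real (Suc j) powr (- 1 / t))) at_top sequentially"
    using potential_not_summable[OF assms] by (rule filterlim_sum_at_top_if_not_summable)
  \<comment> \<open>At \<open>x = 1\<close> the coordinates \<open>N - k\<close> run through \<open>1, \<dots>, N\<close> in reverse order.\<close>
  moreover have "(\<Sum>j<N. V (real (Suc j) powr (- 1 / t)))
      = (\<Sum>k<N. V (orbit_point t (real N) (real k) 1))" for N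
    by (subst sum.nat_diff_reindex[symmetric], rule sum.cong)
       (auto simp: orbit_point_def powr_minus_divide of_nat_diff)
  ultimately show ?thesis by simp
qed

section \<open>The limit potential\<close>

lemma first_branch_has_derivative:
  assumes "t > 0" "0 \<le> x" "x < 1"
  shows "(first_branch t has_real_derivative (1 - x powr t) powr (- (1 + 1 / t))) (at x within {0..<1})"
proof (cases "x = 0")
  case True
  \<comment> \<open>The power \<open>x powr t\<close> need not be differentiable at \<open>0\<close>, so the difference quotient is used.\<close>
  have "((\<lambda>y::real. y powr t) \<longlongrightarrow> 0) (at 0 within {0..<1})"
    using assms by (intro tendsto_zero_powrI[where b = t]) (auto simp: eventually_at_filter)
  then have "((\<lambda>y::real. 1 / (1 - y powr t) powr (1 / t)) \<longlongrightarrow> 1 / (1 - 0) powr (1 / t)) (at 0 within {0..<1})"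
    by (intro tendsto_intros) auto
  then have "((\<lambda>y::real. 1 / (1 - y powr t) powr (1 / t)) \<longlongrightarrow> 1) (at 0 within {0..<1})"
    by simp
  then have "((\<lambda>y. (first_branch t y - first_branch t 0) / (y - 0)) \<longlongrightarrow> 1) (at 0 within {0..<1})"
    by (rule Lim_transform_eventually) (auto simp: first_branch_def eventually_at_filter)
  then show ?thesis
    using True assms by (simp add: has_field_derivative_iff)
next
  case False
  define w where "w = 1 - x powr t"
  have w: "w > 0" using assms False by (simp add: w_def powr01_less_one)
  have "((\<lambda>x. x * (1 - x powr t) powr (- 1 / t)) has_real_derivative
      w powr (- 1 / t) + x * ((- 1 / t) * w powr (- 1 / t - 1) * (- (t * x powr (t - 1))))) (at x)"
    using False assms w unfolding w_def
    by (auto intro!: derivative_eq_intros simp: powr_diff)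
  also have "w powr (- 1 / t) + x * ((- 1 / t) * w powr (- 1 / t - 1) * (- (t * x powr (t - 1))))
      = w powr (- 1 / t) + w powr (- 1 / t - 1) * x powr t"
    using False assms by (simp add: powr_diff)
  also have "\<dots> = w powr (- 1 / t - 1) * (w + x powr t)"
    using w by (simp add: powr_diff field_simps)
  also have "w + x powr t = 1" by (simp add: w_def)
  also have "- 1 / t - 1 = - (1 + 1 / t)" by simp
  also have "w powr (- (1 + 1 / t)) * 1 = w powr (- (1 + 1 / t))" by simp
  also have "(\<lambda>x. x * (1 - x powr t) powr (- 1 / t)) = first_branch t"
    by (auto simp: first_branch_def powr_minus_divide fun_eq_iff)
  finally show ?thesis unfolding w_def by (rule has_field_derivative_at_within)
qed

lemma V_star_eq:
  assumes "t > 0" "0 \<le> x" "x < 1"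
  shows "V_star t x = ereal (- (1 + 1 / t) * ln (1 - x powr t))"
proof -
  have nontrivial: "at x within {0..<1} \<noteq> bot"
    using assms by (simp add: trivial_limit_within)
  have "vector_derivative (first_branch t) (at x within {0..<1}) = (1 - x powr t) powr (- (1 + 1 / t))"
    using first_branch_has_derivative[OF assms] nontrivial
    by (intro vector_derivative_within) (simp_all add: has_real_derivative_iff_has_vector_derivative)
  moreover have "x powr t < 1"
    using assms by (cases "x = 0") (auto simp: powr01_less_one)
  ultimately show ?thesis using assms(3) by (simp add: V_star_def ln_powr)
qed

theorem theorem2p1:
  fixes t x :: real and V :: "real \<Rightarrow> real"
  assumes "t > 0" and "V \<in> potential_class t" and "x \<in> {0..1}"
  shows "(\<lambda>n. ereal ((renorm t ^^ n) V x)) \<longlonglongrightarrow> V_star t x \<and>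
         V_star t x = (if x < 1 then ereal (- (1 + 1 / t) * ln (1 - x powr t)) else \<infinity>)"
proof
  show formula: "V_star t x = (if x < 1 then ereal (- (1 + 1 / t) * ln (1 - x powr t)) else \<infinity>)"
    using V_star_eq[OF assms(1)] assms(3) by (simp add: V_star_def)
  have pow: "filterlim (\<lambda>n. 2 ^ n :: nat) at_top sequentially"
    by (rule filterlim_subseq) (simp add: strict_mono_def)
  have eq: "(renorm t ^^ n) V x = (\<Sum>k<2 ^ n. V (orbit_point t (real (2 ^ n)) (real k) x))" for n
    using renorm_iterate_eq_orbit_sum[OF assms(1,3)] by simp
  consider "x = 0" | "0 < x" "x < 1" | "x = 1" using assms(3) by force
  then show "(\<lambda>n. ereal ((renorm t ^^ n) V x)) \<longlonglongrightarrow> V_star t x"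
  proof cases
    case 1
    then have "(renorm t ^^ n) V x = 0" for n
      unfolding eq using potential_class_zero[OF assms(1,2)] by (simp add: orbit_point_def)
    then show ?thesis using 1 assms(1) formula by simp
  next
    case 2
    have "(\<lambda>n. (renorm t ^^ n) V x) \<longlonglongrightarrow> - (1 + 1 / t) * ln (1 - x powr t)"
      unfolding eq by (rule filterlim_compose[OF orbit_sum_tendsto_interior[OF assms(1,2) 2] pow])
    then show ?thesis unfolding formula using 2 by simp
  next
    case 3
    have "filterlim (\<lambda>n. (renorm t ^^ n) V x) at_top sequentially"
      unfolding eq unfolding 3 by (rule filterlim_compose[OF orbit_sum_diverges_at_1[OF assms(1,2)] pow])
    then show ?thesis unfolding formula using 3
      by (simp add: tendsto_PInfty_eq_at_top)
  qed
qed

end
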